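(* Let $G$ be a non-bipartite graph with $m\geq 51$ edges. If $\rho(G)\geq\rho(S_{m-1}^{2})$ (where $\rho(S_{m-1}^{2})>\sqrt{m-2}$), then $G$ contains a quadrilateral $C_4$ as a subgraph unless $G$ is one of the following graphs: $S_{m}^{1}$, $C_{5}\bullet K_{1,m-5}$, and $S_{m-1}^{2}$.
   Context: All graphs are finite, simple and undirected. $\rho(G)$ denotes the spectral radius (largest adjacency eigenvalue) of $G$. For integers $n,k$, $S_{n}^{k}$ denotes the graph obtained from the star $K_{1,n-1}$ by adding $k$ pairwise disjoint edges among its leaves (its independent set); thus $S_{m-1}^{2}$ and $S_m^1$ both have $m$ edges. $C_{5}\bullet K_{1,m-5}$ denotes the graph obtained by attaching a vertex of the cycle $C_{5}$ to the center vertex of the star $K_{1,m-5}$ (i.e. identifying that vertex of $C_5$ with the center, giving a graph with $m$ edges).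
   Formalization: "G is one of the following graphs" is taken up to isolated vertices of G, since S_m^1 plus an isolated vertex is non-bipartite, has m edges, the same spectral radius and no C_4, and so contradicts the literal claim. *)

theory Defs
  imports
    Complex_Main
    "Graph_Theory.Graph_Theory"
    "Jordan_Normal_Form.Char_Poly"
begin

text \<open>
  A finite simple undirected graph is a \<^locale>\<open>pair_graph\<close> of the library: a finite symmetric
  loop-free digraph without parallel arcs, each undirected edge being a pair of opposite arcs.
\<close>

definition edges :: "'a pair_pre_digraph \<Rightarrow> 'a set set" where
  "edges G = (\<lambda>(u, v). {u, v}) ` parcs G"

definition bipartite :: "'a pair_pre_digraph \<Rightarrow> bool" where
  "bipartite G \<longleftrightarrow>
     (\<exists>X Y. X \<union> Y = pverts G \<and> X \<inter> Y = {} \<and> parcs G \<subseteq> X \<times> Y \<union> Y \<times> X)"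

definition contains_subgraph :: "'a pair_pre_digraph \<Rightarrow> 'b pair_pre_digraph \<Rightarrow> bool" where
  "contains_subgraph G F \<longleftrightarrow>
     (\<exists>H :: 'a pair_pre_digraph. subgraph (with_proj H) (with_proj G) \<and>
        digraph_iso (with_proj H) (with_proj F))"

definition adjacency_matrix :: "'a list \<Rightarrow> 'a pair_pre_digraph \<Rightarrow> real mat" where
  "adjacency_matrix vs G =
     mat (length vs) (length vs) (\<lambda>(i, j). if (vs ! i, vs ! j) \<in> parcs G then 1 else 0)"

text \<open>
  The list \<open>vs\<close> is an ordering of the vertices. Different orderings give similar matrices,
  so the choice does not affect the eigenvalues.
\<close>

definition adjacency_eigenvalues :: "'a pair_pre_digraph \<Rightarrow> real set" where
  "adjacency_eigenvalues G =
     {k. \<exists>vs. distinct vs \<and> set vs = pverts G \<and> eigenvalue (adjacency_matrix vs G) k}"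

definition graph_spectral_radius :: "'a pair_pre_digraph \<Rightarrow> real" where
  "graph_spectral_radius G = Max (adjacency_eigenvalues G)"

definition undirected :: "'a set \<Rightarrow> ('a \<times> 'a) set \<Rightarrow> 'a pair_pre_digraph" where
  "undirected V E = \<lparr> pverts = V, parcs = E \<union> E\<inverse> \<rparr>"

definition cycle_graph :: "nat \<Rightarrow> nat pair_pre_digraph" where
  "cycle_graph n = undirected {0..<n} {(i, Suc i mod n) | i. i < n}"

text \<open>
  \<open>S\<^sub>n\<^sup>k\<close>, meaningful for \<open>2 * k < n\<close>: the star with centre \<open>0\<close> and leaves \<open>1, ..., n - 1\<close>,
  together with the \<open>k\<close> disjoint edges \<open>{1, 2}, {3, 4}, ..., {2 * k - 1, 2 * k}\<close>.
\<close>

definition star_plus :: "nat \<Rightarrow> nat \<Rightarrow> nat pair_pre_digraph" where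
  "star_plus n k = undirected {0..<n}
     ({(0, i) | i. 1 \<le> i \<and> i < n} \<union> {(2 * j + 1, 2 * j + 2) | j. j < k})"

text \<open>\<open>C\<^sub>5 \<bullet> K\<^sub>1\<^sub>,\<^sub>r\<close>: the vertex \<open>0\<close> of the 5-cycle is the centre of a star with \<open>r\<close> new leaves.\<close>

definition C5_star :: "nat \<Rightarrow> nat pair_pre_digraph" where
  "C5_star r = undirected {0..<5 + r}
     (parcs (cycle_graph 5) \<union> {(0, i) | i. 5 \<le> i \<and> i < 5 + r})"

text \<open>
  When graphs are classified by their number of edges, they are identified up to isomorphism
  and up to isolated vertices, which affect neither the edges nor a nonnegative largest
  adjacency eigenvalue. If \<open>G\<close> has no isolated vertices, \<open>is_graph G H\<close> is plain isomorphism.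
\<close>

definition delete_isolated :: "'a pair_pre_digraph \<Rightarrow> 'a pair_pre_digraph" where
  "delete_isolated G = \<lparr> pverts = Field (parcs G), parcs = parcs G \<rparr>"

definition is_graph :: "'a pair_pre_digraph \<Rightarrow> 'b pair_pre_digraph \<Rightarrow> bool" where
  "is_graph G H \<longleftrightarrow> digraph_iso (with_proj (delete_isolated G)) (with_proj H)"

end

theory Submission
  imports Defs "Jordan_Normal_Form.Spectral_Radius"
begin

text \<open>
  Let \<open>x\<close> be an eigenvector of \<open>G\<close> for \<open>k = \<rho>(G)\<close>, scaled so that \<open>x u = 1\<close> is its largest entry in
  absolute value, let \<open>N\<close> be the neighbourhood of \<open>u\<close>, and let \<open>W\<close> be the set of the vertices outside
  \<open>N \<union> {u}\<close>. Write \<open>t, b, e\<close> for the numbers of edges inside \<open>N\<close>, between \<open>N\<close> and \<open>W\<close>, and inside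
  \<open>W\<close>, so that \<open>m = |N| + t + b + e\<close>. If \<open>G\<close> has no quadrilateral, every vertex other than \<open>u\<close> has at
  most one neighbour in \<open>N\<close>. Expanding \<open>k\<^sup>2 x u\<close> over walks of length 2 and applying the eigenvalue
  equation once more to the endpoints of these walks gives \<open>(k - 1)(k\<^sup>2 - |N|) \<le> 2 t + b + 2 e\<close>.

  The number \<open>\<rho>(S\<^sub>m\<^sub>-\<^sub>1\<^sup>2)\<close> is at least the root \<open>r > sqrt (m - 2)\<close> of \<open>(r\<^sup>2 - (m - 2)) (r - 1) = 4\<close>.
  Hence \<open>k \<ge> r\<close> gives \<open>(k - 1)(k\<^sup>2 - (m - 2)) \<ge> 4\<close>, and subtracting the two inequalities yields
  \<open>(k - 3)(t + b + e - 2) \<le> - b\<close>. So at most two edges avoid \<open>u\<close>, and only few configurations remain;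
  the bipartite ones are excluded, which leaves one or two disjoint edges inside \<open>N\<close>.
\<close>

section \<open>Eigenvalues of graphs\<close>

text \<open>An eigenvector indexed by vertices instead of positions in a list \<open>vs\<close>. The
  field is kept general because eigenvalues are first found over the complex numbers.\<close>

definition eigenfunction :: "'a pair_pre_digraph \<Rightarrow> ('a \<Rightarrow> 'b::field) \<Rightarrow> 'b \<Rightarrow> bool" where
  "eigenfunction G x k \<longleftrightarrow>
     (\<exists>v\<in>pverts G. x v \<noteq> 0) \<and> (\<forall>v\<in>pverts G. (\<Sum>w\<in>parcs G `` {v}. x w) = k * x v)"

text \<open>The matrix is written out because \<open>adjacency_matrix\<close> is real, while the
  complex case is used as well.\<close>

lemma (in pair_fin_digraph) eigenvalue_iff_eigenfunction:
  fixes k :: "'b::field"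
  assumes vs: "distinct vs" "set vs = pverts G"
  shows "eigenvalue (mat (length vs) (length vs)
           (\<lambda>(i, j). if (vs ! i, vs ! j) \<in> parcs G then 1 else 0)) k \<longleftrightarrow>
         (\<exists>x. eigenfunction G x k)"
    (is "eigenvalue ?A k \<longleftrightarrow> _")
proof -
  define n where "n = length vs"
  have bij: "bij_betw ((!) vs) {..<n} (pverts G)"
    using bij_betw_nth[OF vs(1), of "{..<n}" "pverts G"] vs(2) by (simp add: n_def)
  have mult: "(?A *\<^sub>v vec n (\<lambda>i. x (vs ! i))) $ i = (\<Sum>w\<in>parcs G `` {vs ! i}. x w)"
    if "i < n" for x and i
  proof -
    have "(?A *\<^sub>v vec n (\<lambda>i. x (vs ! i))) $ i
        = (\<Sum>j<n. (if (vs ! i, vs ! j) \<in> parcs G then 1 else 0) * x (vs ! j))"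
      using that by (simp add: scalar_prod_def n_def atLeast0LessThan)
    also have "\<dots> = (\<Sum>w\<in>pverts G. (if (vs ! i, w) \<in> parcs G then 1 else 0) * x w)"
      by (rule sum.reindex_bij_betw[OF bij])
    also have "\<dots> = (\<Sum>w\<in>parcs G `` {vs ! i}. x w)"
      by (rule sum.mono_neutral_cong_right) (auto simp: pair_finite_verts in_arcsD2)
    finally show ?thesis .
  qed
  have eq: "?A *\<^sub>v vec n (\<lambda>i. x (vs ! i)) = k \<cdot>\<^sub>v vec n (\<lambda>i. x (vs ! i)) \<longleftrightarrow>
      (\<forall>v\<in>pverts G. (\<Sum>w\<in>parcs G `` {v}. x w) = k * x v)" for x
  proof -
    have "?A *\<^sub>v vec n (\<lambda>i. x (vs ! i)) = k \<cdot>\<^sub>v vec n (\<lambda>i. x (vs ! i)) \<longleftrightarrow>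
        (\<forall>i<n. (\<Sum>w\<in>parcs G `` {vs ! i}. x w) = k * x (vs ! i))"
      using mult by (auto simp: vec_eq_iff n_def)
    also have "\<dots> \<longleftrightarrow> (\<forall>v\<in>pverts G. (\<Sum>w\<in>parcs G `` {v}. x w) = k * x v)"
      using bij_betw_imp_surj_on[OF bij] by force
    finally show ?thesis .
  qed
  have nz: "vec n (\<lambda>i. x (vs ! i)) \<noteq> 0\<^sub>v n \<longleftrightarrow> (\<exists>v\<in>pverts G. x v \<noteq> 0)" for x :: "'a \<Rightarrow> 'b"
    using bij_betw_imp_surj_on[OF bij] by (force simp: vec_eq_iff)
  show ?thesis
  proof
    assume "eigenvalue ?A k"
    then obtain v where v: "v \<in> carrier_vec n" "v \<noteq> 0\<^sub>v n" "?A *\<^sub>v v = k \<cdot>\<^sub>v v"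
      by (auto simp: eigenvalue_def eigenvector_def n_def)
    define x where "x = (\<lambda>w. v $ inv_into {..<n} ((!) vs) w)"
    have vx: "v = vec n (\<lambda>i. x (vs ! i))"
      using v(1) bij by (auto simp: x_def vec_eq_iff bij_betw_def)
    have "eigenfunction G x k"
      using eq[of x, folded vx] nz[of x, folded vx] v by (simp add: eigenfunction_def)
    then show "\<exists>x. eigenfunction G x k"
      by blast
  next
    assume "\<exists>x. eigenfunction G x k"
    then obtain x where "eigenfunction G x k" ..
    then have "eigenvector ?A (vec n (\<lambda>i. x (vs ! i))) k"
      using eq[of x] nz[of x] by (simp add: eigenfunction_def eigenvector_def n_def)
    then show "eigenvalue ?A k"
      unfolding eigenvalue_def by blast
  qed
qed

lemma (in pair_fin_digraph) adjacency_eigenvalues_eq: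
  "adjacency_eigenvalues G = {k. \<exists>x. eigenfunction G x k}"
  using eigenvalue_iff_eigenfunction finite_distinct_list[OF pair_finite_verts]
  unfolding adjacency_eigenvalues_def adjacency_matrix_def by blast

text \<open>All orderings give the spectrum of one fixed matrix, which is finite. With nonemptiness
  this makes the \<open>Max\<close> in \<open>graph_spectral_radius\<close> an attained
  maximum.\<close>

lemma (in pair_fin_digraph) finite_adjacency_eigenvalues: "finite (adjacency_eigenvalues G)"
proof -
  obtain vs where vs: "distinct vs" "set vs = pverts G"
    using finite_distinct_list[OF pair_finite_verts] by blast
  have "adjacency_eigenvalues G = spectrum (adjacency_matrix vs G)"
    unfolding spectrum_def adjacency_matrix_def
    using eigenvalue_iff_eigenfunction[OF vs, where 'b = real]
    by (auto simp: adjacency_eigenvalues_eq)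
  moreover have "adjacency_matrix vs G \<in> carrier_mat (length vs) (length vs)"
    by (simp add: adjacency_matrix_def)
  ultimately show ?thesis
    using card_finite_spectrum by metis
qed

text \<open>The form \<open>S\<close> equals its own conjugate because the arcs are symmetric, and
  the eigenvalue equation turns it into \<open>k\<close> times the positive squared norm
  \<open>q\<close>.\<close>

lemma (in pair_graph) eigenvalue_real:
  fixes k :: complex
  assumes z: "eigenfunction G z k"
  shows "k \<in> \<real>"
proof -
  define S where "S = (\<Sum>v\<in>pverts G. \<Sum>w | w \<in> pverts G \<and> (v, w) \<in> parcs G. cnj (z v) * z w)"
  define q where "q = (\<Sum>v\<in>pverts G. (cmod (z v))\<^sup>2)"
  have "S = (\<Sum>w\<in>pverts G. \<Sum>v | v \<in> pverts G \<and> (v, w) \<in> parcs G. cnj (z v) * z w)"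
    unfolding S_def using pair_finite_verts by (intro sum.swap_restrict) auto
  also have "\<dots> = (\<Sum>w\<in>pverts G. \<Sum>v | v \<in> pverts G \<and> (w, v) \<in> parcs G. cnj (z v) * z w)"
    using arcs_symmetric by (intro sum.cong) auto
  also have "\<dots> = cnj S"
    by (simp add: S_def mult.commute)
  finally have "S \<in> \<real>"
    by (metis Reals_cnj_iff)
  have "S = (\<Sum>v\<in>pverts G. cnj (z v) * (\<Sum>w\<in>parcs G `` {v}. z w))"
    unfolding S_def sum_distrib_left by (intro sum.cong) (auto simp: in_arcsD2)
  also have "\<dots> = (\<Sum>v\<in>pverts G. k * (cnj (z v) * z v))"
    using z by (intro sum.cong) (auto simp: eigenfunction_def)
  also have "\<dots> = k * complex_of_real q"
    by (simp add: q_def sum_distrib_left mult.commute flip: complex_norm_square)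
  finally have "S = k * complex_of_real q" .
  moreover have "q > 0"
    using z pair_finite_verts by (force simp: q_def eigenfunction_def intro: sum_pos2)
  ultimately have "k = S / complex_of_real q"
    by simp
  with \<open>S \<in> \<real>\<close> show ?thesis
    by simp
qed

text \<open>A complex eigenvalue exists and is real. Hence the real and the imaginary part of its
  eigenfunction satisfy the same equations, and one of them is nonzero.\<close>

lemma (in pair_graph) adjacency_eigenvalues_nonempty:
  assumes "pverts G \<noteq> {}"
  shows "adjacency_eigenvalues G \<noteq> {}"
proof -
  obtain vs where vs: "distinct vs" "set vs = pverts G"
    using finite_distinct_list[OF pair_finite_verts] by blast
  then have "spectrum (mat (length vs) (length vs)
      (\<lambda>(i, j). if (vs ! i, vs ! j) \<in> parcs G then 1 else 0) :: complex mat) \<noteq> {}"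
    using assms by (intro spectrum_non_empty[of _ "length vs"]) auto
  then obtain z :: "'a \<Rightarrow> complex" and k where z: "eigenfunction G z k"
    unfolding spectrum_def using eigenvalue_iff_eigenfunction[OF vs] by blast
  with eigenvalue_real obtain r where r: "k = complex_of_real r"
    by (metis Reals_cases)
  have sums: "(\<Sum>w\<in>parcs G `` {v}. z w) = complex_of_real r * z v" if "v \<in> pverts G" for v
    using z r that by (auto simp: eigenfunction_def)
  have "(\<Sum>w\<in>parcs G `` {v}. Re (z w)) = r * Re (z v)"
       "(\<Sum>w\<in>parcs G `` {v}. Im (z w)) = r * Im (z v)" if "v \<in> pverts G" for v
    using arg_cong[OF sums[OF that], of Re] arg_cong[OF sums[OF that], of Im] by simp_all
  moreover have "\<exists>v\<in>pverts G. Re (z v) \<noteq> 0 \<or> Im (z v) \<noteq> 0"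
    using z by (auto simp: eigenfunction_def complex_eq_iff)
  ultimately have "eigenfunction G (\<lambda>v. Re (z v)) r \<or> eigenfunction G (\<lambda>v. Im (z v)) r"
    by (auto simp: eigenfunction_def)
  then show ?thesis
    unfolding adjacency_eigenvalues_eq by blast
qed

lemma (in pair_graph) eigenfunction_spectral_radius:
  assumes "pverts G \<noteq> {}"
  obtains x where "eigenfunction G x (graph_spectral_radius G)"
  using Max_in[OF finite_adjacency_eigenvalues adjacency_eigenvalues_nonempty[OF assms]] that
  unfolding graph_spectral_radius_def adjacency_eigenvalues_eq by blast

lemma (in pair_graph) eigenvalue_le_spectral_radius:
  assumes "eigenfunction G x k"
  shows "k \<le> graph_spectral_radius G"
  using assms finite_adjacency_eigenvalues
  unfolding graph_spectral_radius_def adjacency_eigenvalues_eq by (auto intro: Max_ge)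

section \<open>Counting arcs\<close>

lemma (in pair_graph) finite_neighbours: "finite (parcs G `` {v})"
  using pair_finite_verts in_arcsD2 by (auto intro: finite_subset[of _ "pverts G"])

lemma (in pair_graph) finite_subset_verts: "A \<subseteq> pverts G \<Longrightarrow> finite A"
  using pair_finite_verts by (rule rev_finite_subset)

text \<open>Double counting: reversal matches the arcs from \<open>A\<close> to \<open>B\<close>
  with those from \<open>B\<close> to \<open>A\<close>.\<close>

lemma (in pair_graph) sum_arcs_swap:
  assumes "A \<subseteq> pverts G" "B \<subseteq> pverts G"
  shows "(\<Sum>v\<in>A. \<Sum>w\<in>parcs G `` {v} \<inter> B. f v w) = (\<Sum>w\<in>B. \<Sum>v\<in>parcs G `` {w} \<inter> A. f v w)"
proof -
  have "parcs G `` {v} \<inter> B = {w\<in>B. (v, w) \<in> parcs G}" for v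
    by auto
  moreover have "parcs G `` {w} \<inter> A = {v\<in>A. (v, w) \<in> parcs G}" for w
    using arcs_symmetric by blast
  ultimately show ?thesis
    using sum.swap_restrict[OF assms[THEN finite_subset_verts], of f "\<lambda>v w. (v, w) \<in> parcs G"]
    by presburger
qed

lemma (in pair_graph) card_arcs_eq_sum:
  assumes "A \<subseteq> pverts G"
  shows "card (parcs G \<inter> A \<times> B) = (\<Sum>v\<in>A. card (parcs G `` {v} \<inter> B))"
proof -
  have "parcs G \<inter> A \<times> B = Sigma A (\<lambda>v. parcs G `` {v} \<inter> B)"
    by auto
  then show ?thesis
    using finite_subset_verts[OF assms] finite_neighbours by (simp add: card_SigmaI)
qed

lemma (in pair_graph) card_arcs: "card (parcs G) = 2 * card (edges G)"
proof -
  have "card (parcs G) = (\<Sum>a\<in>parcs G. 1)"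
    by simp
  also have "\<dots> = (\<Sum>e\<in>edges G. \<Sum>a | a \<in> parcs G \<and> (\<lambda>(u, v). {u, v}) a = e. 1)"
    using pair_finite_arcs by (intro sum.group[symmetric]) (auto simp: edges_def)
  also have "\<dots> = (\<Sum>e\<in>edges G. card {a\<in>parcs G. (\<lambda>(u, v). {u, v}) a = e})"
    by simp
  also have "\<dots> = (\<Sum>e\<in>edges G. 2)"
  proof (rule sum.cong)
    fix e assume "e \<in> edges G"
    then obtain u v where uv: "(u, v) \<in> parcs G" "e = {u, v}"
      by (auto simp: edges_def)
    then have "{a\<in>parcs G. (\<lambda>(u, v). {u, v}) a = e} = {(u, v), (v, u)}" "u \<noteq> v"
      using arcs_symmetric no_loops' by (auto simp: doubleton_eq_iff)
    then show "card {a\<in>parcs G. (\<lambda>(u, v). {u, v}) a = e} = 2"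
      by simp
  qed simp
  finally show ?thesis
    by simp
qed

text \<open>Arcs inside \<open>A\<close> come in opposite pairs. In \<open>arc_counts\<close> this
  rules out that \<open>\<tau>\<close> and \<open>\<epsilon>\<close> are both 1.\<close>

lemma (in pair_graph) card_arcs_ne_1:
  "card (parcs G \<inter> A \<times> A) \<noteq> 1"
proof
  assume "card (parcs G \<inter> A \<times> A) = 1"
  then obtain a b where ab: "parcs G \<inter> A \<times> A = {(a, b)}"
    by (auto simp: card_1_singleton_iff)
  then have "(a, b) \<in> parcs G \<inter> A \<times> A"
    by (simp only: singletonI)
  then have "(b, a) \<in> parcs G \<inter> A \<times> A" "a \<noteq> b"
    using arcs_symmetric no_loops' by auto
  with ab show False
    by simp
qed

lemma (in pair_graph) symmetric_card_2E:
  assumes "S \<subseteq> parcs G" "sym S" "card S = 2"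
  obtains a b where "S = {(a, b), (b, a)}" "a \<noteq> b"
proof -
  from assms(3) have "S \<noteq> {}"
    by auto
  then obtain a b where ab: "(a, b) \<in> S"
    by (metis equals0I surj_pair)
  then have "(b, a) \<in> S" "a \<noteq> b"
    using assms(1,2) no_loops' by (auto dest: symD)
  moreover have "{(a, b), (b, a)} = S"
    using ab calculation assms(3) by (intro card_subset_eq) (auto intro: card_ge_0_finite)
  ultimately show thesis
    using that by blast
qed

lemma (in pair_graph) sym_arcs_square: "sym (parcs G \<inter> A \<times> A)"
  using arcs_symmetric by (auto intro: symI)

lemma (in pair_graph) bipartiteI:
  assumes "X \<union> Y = pverts G" "X \<inter> Y = {}" "parcs G \<inter> X \<times> X = {}" "parcs G \<inter> Y \<times> Y = {}"
  shows "bipartite G"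
proof -
  have "parcs G \<subseteq> X \<times> Y \<union> Y \<times> X"
  proof (rule subrelI)
    fix v w assume vw: "(v, w) \<in> parcs G"
    then have "v \<in> X \<union> Y" "w \<in> X \<union> Y"
      using assms(1) in_arcsD1 in_arcsD2 by blast+
    with vw assms(3,4) show "(v, w) \<in> X \<times> Y \<union> Y \<times> X"
      by blast
  qed
  with assms(1,2) show ?thesis
    unfolding bipartite_def by blast
qed

section \<open>Isomorphisms\<close>

text \<open>The isomorphism is the inverse of \<open>f\<close>, since
  \<open>contains_subgraph\<close> and \<open>is_graph\<close> place the concrete graph on the right
  of \<open>digraph_iso\<close>.\<close>

lemma digraph_iso_image:
  assumes inj: "inj_on f (pverts H)" and arcs: "parcs H \<subseteq> pverts H \<times> pverts H"
  shows "digraph_iso (with_proj \<lparr>pverts = f ` pverts H, parcs = map_prod f f ` parcs H\<rparr>) (with_proj H)"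
proof -
  let ?G = "with_proj \<lparr>pverts = f ` pverts H, parcs = map_prod f f ` parcs H\<rparr>"
  define g where "g = the_inv_into (pverts H) f"
  have gf: "g (f v) = v" if "v \<in> pverts H" for v
    unfolding g_def by (rule the_inv_into_f_f[OF inj that])
  define h where "h = \<lparr>iso_verts = g, iso_arcs = map_prod g g, iso_head = snd, iso_tail = fst\<rparr>"
  have "inj_on g (f ` pverts H)"
    using gf by (auto simp: inj_on_def)
  moreover have "inj_on (map_prod g g) (map_prod f f ` parcs H)"
    by (rule inj_on_inverseI[where g = "map_prod f f"]) (use gf arcs in auto)
  moreover have "wf_digraph ?G"
    using arcs by unfold_locales auto
  ultimately have "pre_digraph.digraph_isomorphism ?G h"
    by (simp add: pre_digraph.digraph_isomorphism_def h_def)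
  moreover have "g ` f ` pverts H = pverts H"
    using gf by (simp add: image_image)
  moreover have "map_prod g g ` map_prod f f ` parcs H = parcs H"
  proof -
    have "map_prod g g (map_prod f f a) = a" if "a \<in> parcs H" for a
      using gf arcs that by (cases a) auto
    then show ?thesis
      by (simp add: image_image)
  qed
  ultimately show ?thesis
    unfolding digraph_iso_def by (intro exI[of _ h]) (simp add: app_iso_def h_def with_proj_def)
qed

text \<open>Consecutive vertices differ because there are no loops, so the two inequalities make all
  four vertices distinct.\<close>

lemma (in pair_graph) contains_C4I:
  assumes cycle: "(a, b) \<in> parcs G" "(b, c) \<in> parcs G" "(c, d) \<in> parcs G" "(d, a) \<in> parcs G"
    and neq: "a \<noteq> c" "b \<noteq> d"
  shows "contains_subgraph G (cycle_graph 4)"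
proof -
  define f where "f = (!) [a, b, c, d]"
  have verts: "pverts (cycle_graph 4) = {0, 1, 2, 3}"
    by (auto simp: cycle_graph_def undirected_def)
  have less_4: "i < 4 \<longleftrightarrow> i = 0 \<or> i = 1 \<or> i = 2 \<or> i = 3" for i :: nat
    by auto
  have "{(i, Suc i mod 4) | i. i < 4} = {(0, 1), (1, 2), (2, 3), (3, 0::nat)}"
    unfolding less_4 by auto
  then have arcs: "parcs (cycle_graph 4) =
      {(0, 1), (1, 2), (2, 3), (3, 0), (1, 0), (2, 1), (3, 2), (0, 3)}"
    by (auto simp: cycle_graph_def undirected_def)
  define H where "H = \<lparr>pverts = f ` pverts (cycle_graph 4),
    parcs = map_prod f f ` parcs (cycle_graph 4)\<rparr>"
  have f: "f 0 = a" "f 1 = b" "f 2 = c" "f 3 = d" "f (Suc 0) = b"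
    by (simp_all add: f_def)
  have "digraph_iso (with_proj H) (with_proj (cycle_graph 4))"
    unfolding H_def
  proof (rule digraph_iso_image)
    show "inj_on f (pverts (cycle_graph 4))"
      using cycle neq no_loops' by (auto simp: verts f)
  qed (simp add: verts arcs)
  moreover have "subgraph (with_proj H) (with_proj G)"
  proof -
    have "wf_digraph (with_proj H)"
      by unfold_locales (auto simp: H_def verts arcs)
    moreover have "wf_digraph (with_proj G)"
      by unfold_locales
    moreover have "pverts H \<subseteq> pverts G" "parcs H \<subseteq> parcs G"
      using cycle arcs_symmetric in_arcsD1 by (auto simp: H_def verts arcs f)
    ultimately show ?thesis
      by (simp add: subgraph_def compatible_def)
  qed
  ultimately show ?thesis
    unfolding contains_subgraph_def by blast
qed

text \<open>Vertex \<open>i\<close> of the model corresponds to entry \<open>i\<close> of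
  \<open>u # zs\<close>, so the ends of the extra edges must come first in \<open>zs\<close>, in
  pairs. A nonempty \<open>zs\<close> keeps \<open>u\<close> from being deleted as isolated.\<close>

lemma is_graph_star_plusI:
  assumes distinct: "distinct (u # zs)" and len: "2 * k \<le> length zs" and "zs \<noteq> []"
    and M: "M = {(zs ! (2 * j), zs ! (2 * j + 1)) | j. j < k}"
    and arcs: "parcs G = {u} \<times> set zs \<union> set zs \<times> {u} \<union> M \<union> M\<inverse>"
  shows "is_graph G (star_plus (Suc (length zs)) k)"
proof -
  let ?n = "Suc (length zs)"
  define f where "f = (!) (u # zs)"
  have verts: "pverts (star_plus ?n k) = {0..<?n}"
    by (simp add: star_plus_def undirected_def)
  have image: "f ` {0..<?n} = insert u (set zs)"
    using nth_image[of ?n "u # zs"] by (simp add: f_def)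
  have inj: "inj_on f {0..<?n}"
    using inj_on_nth[OF distinct] by (simp add: f_def)
  have star: "f ` {i. 1 \<le> i \<and> i < ?n} = set zs"
  proof -
    have "{i. 1 \<le> i \<and> i < ?n} = Suc ` {0..<length zs}"
      unfolding image_Suc_atLeastLessThan by auto
    moreover have "f ` Suc ` {0..<length zs} = (!) zs ` {0..<length zs}"
      unfolding image_image f_def by simp
    ultimately show ?thesis
      by (simp add: nth_image)
  qed
  have "map_prod f f ` {(0, i) | i. 1 \<le> i \<and> i < ?n} = {f 0} \<times> f ` {i. 1 \<le> i \<and> i < ?n}"
    by force
  also have "\<dots> = {u} \<times> set zs"
    unfolding star by (simp add: f_def)
  finally have "map_prod f f ` {(0, i) | i. 1 \<le> i \<and> i < ?n} = {u} \<times> set zs" .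
  moreover have "map_prod f f ` {(2 * j + 1, 2 * j + 2) | j. j < k} = M"
  proof -
    have "map_prod f f ` {(2 * j + 1, 2 * j + 2) | j. j < k} = {(f (2 * j + 1), f (2 * j + 2)) | j. j < k}"
      by force
    also have "\<dots> = M"
      unfolding M by (simp add: f_def)
    finally show ?thesis .
  qed
  moreover have "map_prod f f ` (R \<union> S \<union> (R \<union> S)\<inverse>)
      = map_prod f f ` R \<union> (map_prod f f ` R)\<inverse> \<union> map_prod f f ` S \<union> (map_prod f f ` S)\<inverse>" for R S
    by force
  ultimately have "map_prod f f ` parcs (star_plus ?n k) = parcs G"
    unfolding star_plus_def undirected_def arcs by auto
  moreover have "M \<subseteq> set zs \<times> set zs"
    using len unfolding M by auto
  then have "Field (parcs G) = insert u (set zs)"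
    using \<open>zs \<noteq> []\<close> by (cases zs) (auto simp: Field_def arcs)
  ultimately have "delete_isolated G =
      \<lparr>pverts = f ` pverts (star_plus ?n k), parcs = map_prod f f ` parcs (star_plus ?n k)\<rparr>"
    by (simp add: delete_isolated_def verts image)
  moreover have "parcs (star_plus ?n k) \<subseteq> pverts (star_plus ?n k) \<times> pverts (star_plus ?n k)"
    using len by (auto simp: star_plus_def undirected_def)
  ultimately show ?thesis
    unfolding is_graph_def using digraph_iso_image[of f "star_plus ?n k"] inj by (simp add: verts)
qed

section \<open>Eigenvectors of quadrilateral-free graphs\<close>

text \<open>Stated with closed walks: a failure supplies the assumptions of
  \<open>contains_C4I\<close>, and the condition says that two distinct vertices have at most one
  common neighbour.\<close>

definition C4_free :: "'a pair_pre_digraph \<Rightarrow> bool" where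
  "C4_free G \<longleftrightarrow> (\<forall>a b c d. (a, b) \<in> parcs G \<and> (b, c) \<in> parcs G \<and> (c, d) \<in> parcs G \<and>
     (d, a) \<in> parcs G \<longrightarrow> a = c \<or> b = d)"

text \<open>All estimates rest on the upper bound 1 for the entries, attained at \<open>u\<close>;
  entries of \<open>x\<close> may be negative.\<close>

locale C4_free_eigenfunction = pair_graph G for G :: "'a pair_pre_digraph" +
  fixes x :: "'a \<Rightarrow> real" and k :: real and u :: 'a
  assumes C4_free: "C4_free G"
    and k_gt_1: "k > 1"
    and neighbour_sum: "\<And>v. v \<in> pverts G \<Longrightarrow> (\<Sum>w\<in>parcs G `` {v}. x w) = k * x v"
    and u: "u \<in> pverts G" "x u = 1"
    and x_le_1: "\<And>v. v \<in> pverts G \<Longrightarrow> x v \<le> 1"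
begin

section \<open>Neighbourhoods relative to \<open>u\<close>\<close>

definition "N = parcs G `` {u}"
definition "W = pverts G - insert u N"

abbreviation "P v \<equiv> parcs G `` {v} \<inter> N"
abbreviation "Q v \<equiv> parcs G `` {v} \<inter> W"

lemma N_subset: "N \<subseteq> pverts G" and W_subset: "W \<subseteq> pverts G"
  using in_arcsD2 by (auto simp: N_def W_def)

lemma finite_N: "finite N" and finite_W: "finite W"
  using N_subset W_subset finite_subset_verts by auto

lemma u_notin: "u \<notin> N" "u \<notin> W"
  using no_loops' by (auto simp: N_def W_def)

lemma N_W_disjoint: "N \<inter> W = {}"
  by (auto simp: W_def)

lemma verts_eq: "pverts G = insert u (N \<union> W)"
  using N_subset u by (auto simp: W_def)

lemma neighbours_subset: "parcs G `` {v} \<subseteq> insert u (N \<union> W)"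
  using in_arcsD2 unfolding verts_eq by blast

lemma neighbours_N:
  assumes "v \<in> N"
  shows "parcs G `` {v} = insert u (P v \<union> Q v)"
proof -
  have "u \<in> parcs G `` {v}"
    using assms arcs_symmetric[of u v] by (simp add: N_def)
  then show ?thesis
    using neighbours_subset[of v] by blast
qed

lemma neighbours_W:
  assumes "v \<in> W"
  shows "parcs G `` {v} = P v \<union> Q v"
proof -
  have "u \<notin> parcs G `` {v}"
    using assms arcs_symmetric[of v u] by (auto simp: N_def W_def)
  then show ?thesis
    using neighbours_subset[of v] by blast
qed

lemma finite_P: "finite (P v)" and finite_Q: "finite (Q v)"
  using finite_neighbours by auto

text \<open>A second vertex \<open>w'\<close> of \<open>P v\<close> would close the quadrilateral
  \<open>u\<close>, \<open>w\<close>, \<open>v\<close>, \<open>w'\<close>. All consequences of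
  \<open>C4_free\<close> in this locale pass through this fact.\<close>

lemma P_eq_singleton:
  assumes "w \<in> P v" "v \<noteq> u"
  shows "P v = {w}"
proof -
  have "w' = w" if "w' \<in> P v" for w'
    using C4_free assms that arcs_symmetric unfolding C4_free_def N_def
    by (metis (no_types, lifting) Image_singleton_iff IntE)
  with assms(1) show ?thesis
    by blast
qed

lemma card_P_le_1:
  assumes "v \<noteq> u"
  shows "card (P v) \<le> 1"
proof (cases "P v = {}")
  case False
  then obtain w where "w \<in> P v"
    by blast
  then have "P v = {w}"
    using assms by (rule P_eq_singleton)
  then show ?thesis
    by simp
qed simp

lemma sum_P_Q: "sum f (P v \<union> Q v) = sum f (P v) + sum f (Q v)"
  using N_W_disjoint by (intro sum.union_disjoint finite_P finite_Q) blast

lemma sum_neighbours_N: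
  assumes "v \<in> N"
  shows "sum f (parcs G `` {v}) = f u + sum f (P v) + sum f (Q v)"
proof -
  have "u \<notin> P v \<union> Q v"
    using u_notin by blast
  then have "sum f (insert u (P v \<union> Q v)) = f u + sum f (P v \<union> Q v)"
    using finite_P finite_Q by (intro sum.insert) blast+
  then show ?thesis
    by (simp only: neighbours_N[OF assms, symmetric] sum_P_Q add.assoc)
qed

lemma sum_neighbours_W:
  assumes "v \<in> W"
  shows "sum f (parcs G `` {v}) = sum f (P v) + sum f (Q v)"
  by (simp only: neighbours_W[OF assms, symmetric] flip: sum_P_Q)

section \<open>Edge counts\<close>

text \<open>Arcs are counted, so an edge inside \<open>N\<close> or inside \<open>W\<close> contributes 2 to \<open>\<tau>\<close> or \<open>\<epsilon>\<close>.\<close>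

abbreviation "\<tau> \<equiv> card (parcs G \<inter> N \<times> N)"
abbreviation "\<beta> \<equiv> card (parcs G \<inter> N \<times> W)"
abbreviation "\<epsilon> \<equiv> card (parcs G \<inter> W \<times> W)"

lemma tau_eq: "\<tau> = (\<Sum>v\<in>N. card (P v))"
  and beta_eq: "\<beta> = (\<Sum>v\<in>N. card (Q v))"
  and beta_eq': "\<beta> = (\<Sum>v\<in>W. card (P v))"
  and epsilon_eq: "\<epsilon> = (\<Sum>v\<in>W. card (Q v))"
  using sum_arcs_swap[OF N_subset W_subset, of "\<lambda>_ _. 1::nat"]
  by (simp_all add: card_arcs_eq_sum N_subset W_subset)

text \<open>Degree sum: \<open>u\<close> contributes \<open>card N\<close>, the vertices of
  \<open>N\<close> contribute \<open>card N + \<tau> + \<beta>\<close>, and those of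
  \<open>W\<close> contribute \<open>\<beta> + \<epsilon>\<close>.\<close>

lemma twice_card_edges: "2 * card (edges G) = 2 * card N + \<tau> + 2 * \<beta> + \<epsilon>"
proof -
  have "card (parcs G) = (\<Sum>v\<in>pverts G. \<Sum>w\<in>parcs G `` {v}. 1)"
    using card_arcs_eq_sum[of "pverts G" UNIV] in_arcsD1 by (auto simp: Int_absorb2 subset_iff)
  also have "\<dots> = (\<Sum>w\<in>parcs G `` {u}. 1) + (\<Sum>v\<in>N. \<Sum>w\<in>parcs G `` {v}. 1) +
      (\<Sum>v\<in>W. \<Sum>w\<in>parcs G `` {v}. 1)"
    using u_notin N_W_disjoint finite_N finite_W
    by (simp add: verts_eq sum.union_disjoint del: sum_constant)
  also have "(\<Sum>v\<in>N. \<Sum>w\<in>parcs G `` {v}. 1) = (\<Sum>v\<in>N. 1 + card (P v) + card (Q v))"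
    by (intro sum.cong refl) (simp add: sum_neighbours_N del: sum_constant, simp)
  also have "\<dots> = card N + \<tau> + \<beta>"
    unfolding tau_eq beta_eq by (simp only: sum.distrib card_eq_sum)
  also have "(\<Sum>v\<in>W. \<Sum>w\<in>parcs G `` {v}. 1) = (\<Sum>v\<in>W. card (P v) + card (Q v))"
    by (intro sum.cong refl) (simp add: sum_neighbours_W del: sum_constant, simp)
  also have "\<dots> = \<beta> + \<epsilon>"
    unfolding beta_eq' epsilon_eq by (simp only: sum.distrib)
  finally show ?thesis
    by (simp add: card_arcs flip: N_def)
qed

section \<open>Walks of length 2 from \<open>u\<close> and the spectral bound\<close>

lemma sum_Q_le:
  assumes "B \<subseteq> N"
  shows "k * (\<Sum>v\<in>B. \<Sum>w\<in>Q v. x w) \<le> real \<beta> + real \<epsilon>"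
proof -
  have "k * (\<Sum>v\<in>B. \<Sum>w\<in>Q v. x w) = (\<Sum>v\<in>B. \<Sum>w\<in>Q v. k * x w)"
    by (simp add: sum_distrib_left)
  also have "\<dots> \<le> (\<Sum>v\<in>B. \<Sum>w\<in>Q v. 1 + real (card (Q w)))"
  proof (intro sum_mono)
    \<comment> \<open>Since \<open>v\<close> is the only neighbour of \<open>w\<close> in
      \<open>N\<close>, the eigenvalue equation at \<open>w\<close> involves just \<open>x v\<close>
      and the entries on \<open>Q w\<close>, each at most 1.\<close>
    fix v w assume "v \<in> B" and w: "w \<in> Q v"
    with assms have "v \<in> P w" "v \<in> pverts G"
      using arcs_symmetric N_subset by auto
    moreover have "w \<in> W" "w \<in> pverts G" "w \<noteq> u"
      using w W_subset u_notin by auto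
    moreover from calculation have "P w = {v}"
      by (intro P_eq_singleton)
    ultimately have "k * x w = x v + (\<Sum>y\<in>Q w. x y)"
      using neighbour_sum[of w] sum_neighbours_W[of w x] by simp
    also have "\<dots> \<le> 1 + (\<Sum>y\<in>Q w. 1)"
      using x_le_1 \<open>v \<in> pverts G\<close> W_subset by (intro add_mono sum_mono) auto
    finally show "k * x w \<le> 1 + real (card (Q w))"
      by simp
  qed
  \<comment> \<open>Enlarging \<open>B\<close> to \<open>N\<close> is legitimate here because the
    summands are now nonnegative, which the entries \<open>x w\<close> need not be.\<close>
  also have "\<dots> \<le> (\<Sum>v\<in>N. \<Sum>w\<in>Q v. 1 + real (card (Q w)))"
    using assms finite_N by (intro sum_mono2 sum_nonneg) auto
  also have "\<dots> = \<beta> + (\<Sum>v\<in>N. \<Sum>w\<in>Q v. real (card (Q w)))"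
    by (simp add: sum.distrib beta_eq)
  also have "(\<Sum>v\<in>N. \<Sum>w\<in>Q v. real (card (Q w))) = (\<Sum>w\<in>W. card (P w) * card (Q w))"
    by (simp add: sum_arcs_swap[OF N_subset W_subset])
  also have "\<dots> \<le> \<epsilon>"
  proof -
    have "card (P w) * card (Q w) \<le> card (Q w)" if "w \<in> W" for w
      using mult_le_mono1[OF card_P_le_1, of w "card (Q w)"] that u_notin by auto
    then show ?thesis
      unfolding epsilon_eq of_nat_le_iff by (rule sum_mono)
  qed
  finally show ?thesis
    by simp
qed

text \<open>The eigenvalue equation is applied twice, at \<open>u\<close> and at its neighbours.
  Each \<open>v\<close> in \<open>N\<close> gives one walk back to \<open>u\<close>, which accounts
  for \<open>card N\<close>.\<close>

lemma k_squared: "k\<^sup>2 = card N + (\<Sum>v\<in>N. \<Sum>w\<in>P v. x w) + (\<Sum>v\<in>N. \<Sum>w\<in>Q v. x w)"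
proof -
  have "k\<^sup>2 = k * (\<Sum>v\<in>N. x v)"
    using neighbour_sum[OF u(1)] u(2) by (simp add: N_def power2_eq_square)
  also have "\<dots> = (\<Sum>v\<in>N. \<Sum>w\<in>parcs G `` {v}. x w)"
    using neighbour_sum N_subset by (auto simp: sum_distrib_left intro!: sum.cong)
  also have "\<dots> = (\<Sum>v\<in>N. 1 + (\<Sum>w\<in>P v. x w) + (\<Sum>w\<in>Q v. x w))"
    using u(2) by (intro sum.cong refl) (simp add: sum_neighbours_N)
  finally show ?thesis
    by (simp add: sum.distrib)
qed

text \<open>An endpoint \<open>w\<close> in \<open>N\<close> of a walk through \<open>v\<close> has
  only \<open>u\<close>, \<open>v\<close> and \<open>Q w\<close> as neighbours. Summed over all such
  walks, the terms \<open>x v\<close> reproduce the sum on the left, so the factor \<open>k\<close>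
  drops to \<open>k - 1\<close>.\<close>

lemma sum_P:
  "(k - 1) * (\<Sum>v\<in>N. \<Sum>w\<in>P v. x w) = \<tau> + (\<Sum>v | v \<in> N \<and> P v \<noteq> {}. \<Sum>w\<in>Q v. x w)"
proof -
  have "k * (\<Sum>v\<in>N. \<Sum>w\<in>P v. x w) = (\<Sum>v\<in>N. \<Sum>w\<in>P v. k * x w)"
    by (simp add: sum_distrib_left)
  also have "\<dots> = (\<Sum>v\<in>N. \<Sum>w\<in>P v. 1 + x v + (\<Sum>y\<in>Q w. x y))"
  proof (intro sum.cong refl)
    fix v w assume v: "v \<in> N" and w: "w \<in> P v"
    then have "v \<in> P w" "w \<in> N" "w \<in> pverts G" "w \<noteq> u"
      using arcs_symmetric N_subset u_notin by auto
    moreover from calculation have "P w = {v}"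
      by (intro P_eq_singleton)
    ultimately show "k * x w = 1 + x v + (\<Sum>y\<in>Q w. x y)"
      using neighbour_sum[of w] sum_neighbours_N[of w x] u(2) by simp
  qed
  also have "\<dots> = (\<Sum>w\<in>N. \<Sum>v\<in>P w. 1 + x v + (\<Sum>y\<in>Q w. x y))"
    by (rule sum_arcs_swap[OF N_subset N_subset])
  also have "\<dots> = \<tau> + (\<Sum>v\<in>N. \<Sum>w\<in>P v. x w) + (\<Sum>v\<in>N. card (P v) * (\<Sum>w\<in>Q v. x w))"
    by (simp add: sum.distrib tau_eq)
  also have "(\<Sum>v\<in>N. card (P v) * (\<Sum>w\<in>Q v. x w)) = (\<Sum>v | v \<in> N \<and> P v \<noteq> {}. \<Sum>w\<in>Q v. x w)"
  proof (rule sum.mono_neutral_cong_right)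
    show "card (P v) * (\<Sum>w\<in>Q v. x w) = (\<Sum>w\<in>Q v. x w)" if "v \<in> {v. v \<in> N \<and> P v \<noteq> {}}" for v
    proof -
      from that obtain w where "w \<in> P v" "v \<noteq> u"
        using u_notin by auto
      then have "P v = {w}"
        by (rule P_eq_singleton)
      then show ?thesis
        by simp
    qed
  qed (use finite_N in auto)
  finally show ?thesis
    by (simp add: algebra_simps)
qed

text \<open>By \<open>k_squared\<close> and \<open>sum_P\<close> the left side is
  \<open>\<tau> + s' + (k - 1) * s\<close>. After multiplication by \<open>k\<close>,
  \<open>sum_Q_le\<close> bounds both \<open>k * s\<close> and \<open>k * s'\<close> by
  \<open>\<beta> + \<epsilon>\<close>.\<close>

lemma spectral_bound: "(k - 1) * (k\<^sup>2 - card N) \<le> \<tau> + \<beta> + \<epsilon>"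
proof -
  define s where "s = (\<Sum>v\<in>N. \<Sum>w\<in>Q v. x w)"
  define s' where "s' = (\<Sum>v | v \<in> N \<and> P v \<noteq> {}. \<Sum>w\<in>Q v. x w)"
  have "k * ((k - 1) * (k\<^sup>2 - card N)) = k * \<tau> + (k - 1) * (k * s) + k * s'"
    using sum_P by (simp add: k_squared s_def s'_def algebra_simps)
  also have "\<dots> \<le> k * \<tau> + (k - 1) * (\<beta> + \<epsilon>) + (\<beta> + \<epsilon>)"
    using sum_Q_le[of N] sum_Q_le[of "{v. v \<in> N \<and> P v \<noteq> {}}"] k_gt_1
    by (intro add_mono mult_left_mono) (auto simp: s_def s'_def)
  also have "\<dots> = k * (\<tau> + \<beta> + \<epsilon>)"
    by (simp add: algebra_simps)
  finally show ?thesis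
    using k_gt_1 by simp
qed

text \<open>All sums over \<open>Q v\<close> with \<open>v\<close> in \<open>N\<close> are empty.
  Compared with \<open>spectral_bound\<close>, the term \<open>\<epsilon>\<close> disappears, which
  later excludes edges inside \<open>W\<close> in the tight case.\<close>

lemma spectral_equality:
  assumes "\<beta> = 0"
  shows "(k - 1) * (k\<^sup>2 - card N) = \<tau>"
proof -
  have "(\<Sum>v\<in>N. card (Q v)) = 0"
    using assms by (simp only: beta_eq)
  then have Q: "Q v = {}" if "v \<in> N" for v
    using that finite_N finite_Q by (metis card_0_eq sum_eq_0_iff)
  have "(\<Sum>w\<in>Q v. x w) = 0" if "v \<in> N" for v
    using Q[OF that] by (simp only: sum.empty)
  then have "(\<Sum>v\<in>A. \<Sum>w\<in>Q v. x w) = 0" if "A \<subseteq> N" for A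
    using that by (intro sum.neutral) blast
  from this[of N] this[of "{v. v \<in> N \<and> P v \<noteq> {}}"] show ?thesis
    using sum_P k_squared by auto
qed

section \<open>Configurations with few edges avoiding \<open>u\<close>\<close>

lemma finite_arcs_Int: "finite (parcs G \<inter> S)"
  using pair_finite_arcs by simp

lemma no_arcs_u_W: "(u, w) \<in> parcs G \<Longrightarrow> w \<notin> W" "(w, u) \<in> parcs G \<Longrightarrow> w \<notin> W"
  using arcs_symmetric by (auto simp: W_def N_def)

lemma no_arcs_u_u: "(u, u) \<notin> parcs G"
  using no_loops' by blast

lemma bipartite_if_no_inner_arcs:
  assumes "\<tau> = 0" "\<epsilon> = 0"
  shows "bipartite G"
proof (rule bipartiteI)
  show "insert u W \<union> N = pverts G" "insert u W \<inter> N = {}"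
    using verts_eq u_notin N_W_disjoint by auto
  have "parcs G \<inter> W \<times> W = {}"
    using assms(2) finite_arcs_Int by (metis card_0_eq)
  then show "parcs G \<inter> insert u W \<times> insert u W = {}"
    using no_arcs_u_W no_arcs_u_u by blast
  show "parcs G \<inter> N \<times> N = {}"
    using assms(1) finite_arcs_Int by (metis card_0_eq)
qed

text \<open>The graph is a star at \<open>u\<close> together with a separate edge in
  \<open>W\<close>; one end of that edge is moved to the side of \<open>N\<close>.\<close>

lemma bipartite_if_one_outer_edge:
  assumes "\<tau> = 0" "\<beta> = 0" "\<epsilon> = 2"
  shows "bipartite G"
proof -
  obtain a b where ab: "parcs G \<inter> W \<times> W = {(a, b), (b, a)}" "a \<noteq> b"
    using symmetric_card_2E[OF _ sym_arcs_square assms(3)] by blast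
  then have "a \<in> W" "b \<in> W"
    by auto
  have NN: "parcs G \<inter> N \<times> N = {}"
    using assms(1) finite_arcs_Int by (metis card_0_eq)
  have NW: "parcs G \<inter> N \<times> W = {}"
    using assms(2) finite_arcs_Int by (metis card_0_eq)
  then have WN: "parcs G \<inter> W \<times> N = {}"
    using arcs_symmetric by blast
  show ?thesis
  proof (rule bipartiteI)
    show "insert u (W - {a}) \<union> insert a N = pverts G" "insert u (W - {a}) \<inter> insert a N = {}"
      using verts_eq u_notin N_W_disjoint \<open>a \<in> W\<close> by auto
    have "parcs G \<inter> (W - {a}) \<times> (W - {a}) = {}"
      using ab by blast
    then show "parcs G \<inter> insert u (W - {a}) \<times> insert u (W - {a}) = {}"
      using no_arcs_u_W no_arcs_u_u by blast
    show "parcs G \<inter> insert a N \<times> insert a N = {}"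
      using NN NW WN \<open>a \<in> W\<close> no_loops' by blast
  qed
qed

lemma arc_counts:
  assumes "\<not> bipartite G" "k > 3" "(k - 1) * (k\<^sup>2 - (real (card (edges G)) - 2)) \<ge> 4"
  shows "\<beta> = 0 \<and> \<epsilon> = 0 \<and> (\<tau> = 2 \<or> \<tau> = 4)"
proof -
  \<comment> \<open>Twice the number of edges that avoid \<open>u\<close>.\<close>
  define p where "p = \<tau> + 2 * \<beta> + \<epsilon>"
  have "2 * card (edges G) = 2 * card N + p"
    using twice_card_edges by (simp add: p_def)
  then have edges: "real (card (edges G)) = card N + p / 2" and "even p"
    by (linarith, presburger)
  have "(k - 1) * (p / 2 - 2) = (k - 1) * (k\<^sup>2 - card N) - (k - 1) * (k\<^sup>2 - (real (card (edges G)) - 2))"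
    unfolding edges by (simp add: algebra_simps)
  then have le: "(k - 1) * (p / 2 - 2) \<le> (k - 1) * (k\<^sup>2 - card N) - 4"
    using assms(3) by linarith
  have "(k - 1) * (p / 2 - 2) \<le> real p - \<beta> - 4"
    using le spectral_bound by (simp add: p_def)
  then have general: "(k - 3) * (real p - 4) \<le> - 2 * \<beta>"
    by (simp add: field_simps)
  have special: "(k - 3) * (real p - 4) \<le> - 2 * \<epsilon>" if "\<beta> = 0"
  proof -
    have "(k - 1) * (p / 2 - 2) \<le> real p - \<epsilon> - 4"
      using le spectral_equality[OF that] that by (simp add: p_def)
    then show ?thesis
      by (simp add: field_simps)
  qed
  have "p \<le> 4"
  proof (rule ccontr)
    assume "\<not> p \<le> 4"
    then have "(k - 3) * (real p - 4) > 0"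
      using assms(2) by simp
    with general show False
      by simp
  qed
  \<comment> \<open>For \<open>p = 4\<close> the left sides of \<open>general\<close> and
    \<open>special\<close> vanish, which forces first \<open>\<beta> = 0\<close> and then
    \<open>\<epsilon> = 0\<close>.\<close>
  moreover have "p \<noteq> 4" if "\<beta> > 0 \<or> \<epsilon> > 0"
    using general special that by (cases "\<beta> = 0") auto
  moreover have "\<tau> \<noteq> 1" "\<epsilon> \<noteq> 1"
    using card_arcs_ne_1 by blast+
  \<comment> \<open>With \<open>p\<close> at most 2, these are the bipartite cases: no edge inside
    \<open>N\<close> or \<open>W\<close>, or a single edge inside \<open>W\<close> and no other edge
    avoiding \<open>u\<close>.\<close>
  moreover have "\<not> (\<tau> = 0 \<and> \<epsilon> = 0)" "\<not> (\<tau> = 0 \<and> \<beta> = 0 \<and> \<epsilon> = 2)"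
    using assms(1) bipartite_if_no_inner_arcs bipartite_if_one_outer_edge by blast+
  ultimately show ?thesis
    using \<open>even p\<close> unfolding p_def by presburger
qed

section \<open>Identification of the remaining graphs\<close>

lemma arcs_eq:
  assumes "\<beta> = 0" "\<epsilon> = 0"
  shows "parcs G = {u} \<times> N \<union> N \<times> {u} \<union> (parcs G \<inter> N \<times> N)"
proof -
  \<comment> \<open>Every vertex of \<open>W\<close> turns out to be isolated.\<close>
  have NW: "parcs G \<inter> N \<times> W = {}" and WW: "parcs G \<inter> W \<times> W = {}"
    using assms finite_arcs_Int by (metis card_0_eq)+
  then have WN: "parcs G \<inter> W \<times> N = {}"
    using arcs_symmetric by blast
  have "(v, w) \<in> {u} \<times> N \<union> N \<times> {u} \<union> (parcs G \<inter> N \<times> N)" if "(v, w) \<in> parcs G" for v w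
  proof -
    have "v \<in> insert u (N \<union> W)" "w \<in> insert u (N \<union> W)"
      using that in_arcsD1 in_arcsD2 verts_eq by blast+
    then show ?thesis
      using that NW WN WW no_arcs_u_W no_arcs_u_u by blast
  qed
  moreover have "{u} \<times> N \<union> N \<times> {u} \<subseteq> parcs G"
    using arcs_symmetric by (auto simp: N_def)
  ultimately show ?thesis
    by auto
qed

lemma is_graph_star_plus_1:
  assumes "\<beta> = 0" "\<epsilon> = 0" "\<tau> = 2"
  shows "is_graph G (star_plus (card (edges G)) 1)"
proof -
  obtain a b where ab: "parcs G \<inter> N \<times> N = {(a, b), (b, a)}" "a \<noteq> b"
    using symmetric_card_2E[OF _ sym_arcs_square assms(3)] by blast
  then have "a \<in> N" "b \<in> N"
    by auto
  obtain xs where xs: "distinct xs" "set xs = N - {a, b}"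
    using finite_distinct_list[of "N - {a, b}"] finite_N by blast
  \<comment> \<open>The ends of the extra edge come first, so that they take the places of the
    vertices 1 and 2 of the model.\<close>
  define zs where "zs = [a, b] @ xs"
  have zs: "set zs = N" "distinct zs"
    using xs ab \<open>a \<in> N\<close> \<open>b \<in> N\<close> by (auto simp: zs_def)
  have "is_graph G (star_plus (Suc (length zs)) 1)"
  proof (rule is_graph_star_plusI)
    show "parcs G = {u} \<times> set zs \<union> set zs \<times> {u} \<union> {(a, b)} \<union> {(a, b)}\<inverse>"
      using arcs_eq[OF assms(1,2)] zs ab by auto
  qed (use zs u_notin in \<open>auto simp: zs_def\<close>)
  moreover have "card (edges G) = Suc (length zs)"
    using twice_card_edges assms zs distinct_card[of zs] by simp
  ultimately show ?thesis
    by simp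
qed

lemma is_graph_star_plus_2:
  assumes "\<beta> = 0" "\<epsilon> = 0" "\<tau> = 4"
  shows "is_graph G (star_plus (card (edges G) - 1) 2)"
proof -
  have "parcs G \<inter> N \<times> N \<noteq> {}"
    using assms(3) by (metis card.empty zero_neq_numeral)
  then obtain a b where "(a, b) \<in> parcs G \<inter> N \<times> N"
    by blast
  then have ab: "(a, b) \<in> parcs G" "(b, a) \<in> parcs G" "a \<in> N" "b \<in> N" "a \<noteq> b"
    using arcs_symmetric no_loops' by auto
  define S where "S = parcs G \<inter> N \<times> N - {(a, b), (b, a)}"
  have "card S = 2"
    using ab assms(3) by (simp add: S_def card_Diff_subset)
  moreover have "sym S"
    using arcs_symmetric by (auto simp: S_def intro: symI)
  moreover have "S \<subseteq> parcs G"
    by (auto simp: S_def)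
  ultimately obtain c d where cd: "S = {(c, d), (d, c)}" "c \<noteq> d"
    using symmetric_card_2E by metis
  then have "(c, d) \<in> S"
    by simp
  then have cd': "(c, d) \<in> parcs G" "(d, c) \<in> parcs G" "c \<in> N" "d \<in> N" "(c, d) \<noteq> (a, b)" "(c, d) \<noteq> (b, a)"
    using arcs_symmetric by (auto simp: S_def)
  \<comment> \<open>The two edges inside \<open>N\<close> are disjoint because no vertex of
    \<open>N\<close> has two neighbours in \<open>N\<close>.\<close>
  have "P a = {b}" "P b = {a}"
    using ab u_notin by (intro P_eq_singleton; auto)+
  then have distinct: "distinct [a, b, c, d]"
    using ab cd cd' by auto
  obtain xs where xs: "distinct xs" "set xs = N - {a, b, c, d}"
    using finite_distinct_list[of "N - {a, b, c, d}"] finite_N by blast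
  define zs where "zs = [a, b, c, d] @ xs"
  have zs: "set zs = N" "distinct zs"
    using xs ab cd' distinct by (auto simp: zs_def)
  have "parcs G \<inter> N \<times> N = {(a, b), (b, a)} \<union> S"
    using ab unfolding S_def by blast
  then have arcs: "parcs G = {u} \<times> set zs \<union> set zs \<times> {u} \<union> {(a, b), (c, d)} \<union> {(a, b), (c, d)}\<inverse>"
    using arcs_eq[OF assms(1,2)] zs(1) cd(1) by auto
  have "is_graph G (star_plus (Suc (length zs)) 2)"
  proof (rule is_graph_star_plusI[OF _ _ _ _ arcs])
    have "{j. j < 2} = {0, 1::nat}"
      by auto
    then have "{(zs ! (2 * j), zs ! (2 * j + 1)) | j. j < 2} = (\<lambda>j. (zs ! (2 * j), zs ! (2 * j + 1))) ` {0, 1}"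
      by blast
    then show "{(a, b), (c, d)} = {(zs ! (2 * j), zs ! (2 * j + 1)) | j. j < 2}"
      by (simp add: zs_def)
  qed (use zs u_notin in \<open>auto simp: zs_def\<close>)
  moreover have "card (edges G) = Suc (Suc (length zs))"
    using twice_card_edges assms zs distinct_card[of zs] by simp
  ultimately show ?thesis
    by simp
qed

end

section \<open>The spectral radius of the extremal graph\<close>

lemma pair_graph_star_plus:
  assumes "2 * k < n"
  shows "pair_graph (star_plus n k)"
proof
  have arcs: "parcs (star_plus n k) \<subseteq> {0..<n} \<times> {0..<n}"
    using assms by (auto simp: star_plus_def undirected_def)
  then show "finite (parcs (star_plus n k))"
    by (rule finite_subset) simp
  show "symmetric (with_proj (star_plus n k))"
    by (auto simp: symmetric_def star_plus_def undirected_def sym_Un_converse)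
qed (use assms in \<open>auto simp: star_plus_def undirected_def\<close>)

text \<open>With value 1 at the centre, the equation \<open>r * y = 1 + y\<close> on a triangle
  gives \<open>y = 1 / (r - 1)\<close>, and a pendant leaf gets \<open>1 / r\<close>. The equation
  at the centre, \<open>r = 4 / (r - 1) + (n - 5) / r\<close>, is then equivalent to the assumed
  cubic.\<close>

lemma eigenfunction_star_plus_2:
  fixes r :: real
  assumes n: "n \<ge> 5" and r: "r > 1" "(r\<^sup>2 - (real n - 1)) * (r - 1) = 4"
  shows "eigenfunction (star_plus n 2) (\<lambda>i. if i = 0 then 1 else if i \<le> 4 then 1 / (r - 1) else 1 / r) r"
    (is "eigenfunction ?G ?x r")
proof -
  have arc: "(i, j) \<in> parcs ?G \<longleftrightarrow> (i = 0 \<and> 1 \<le> j \<and> j < n) \<or> (j = 0 \<and> 1 \<le> i \<and> i < n) \<or>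
      (i, j) \<in> {(1, 2), (3, 4), (2, 1), (4, 3)}" for i j
    by (auto simp: star_plus_def undirected_def less_2_cases_iff)
  have leaf: "(\<Sum>w\<in>parcs ?G `` {v}. ?x w) = r * ?x v" if "v \<in> pverts ?G" "v \<noteq> 0" for v
  proof -
    from that have "v < n"
      by (auto simp: star_plus_def undirected_def)
    have neighbours: "parcs ?G `` {1} = {0, 2}" "parcs ?G `` {2} = {0, 1}"
      "parcs ?G `` {3} = {0, 4}" "parcs ?G `` {4} = {0, 3}"
      unfolding Image_singleton arc using n by auto
    have neighbours': "parcs ?G `` {v} = {0}" if "v > 4"
      unfolding Image_singleton arc using \<open>v < n\<close> that by auto
    consider "v = 1" | "v = 2" | "v = 3" | "v = 4" | "v > 4"
      using \<open>v \<noteq> 0\<close> by linarith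
    then show ?thesis
      using r(1) by cases (simp_all only: neighbours neighbours', simp_all add: field_simps)
  qed
  have "parcs ?G `` {0} = {1..4} \<union> {5..<n}"
    unfolding Image_singleton arc using n by auto
  then have "(\<Sum>w\<in>parcs ?G `` {0}. ?x w) = (\<Sum>w\<in>{1..4}. ?x w) + (\<Sum>w\<in>{5..<n}. ?x w)"
    by (simp only:) (rule sum.union_disjoint; auto)
  also have "(\<Sum>w\<in>{1..4}. ?x w) = (\<Sum>w\<in>{1..4::nat}. 1 / (r - 1))"
    by (intro sum.cong) auto
  also have "(\<Sum>w\<in>{5..<n}. ?x w) = (\<Sum>w\<in>{5..<n}. 1 / r)"
    by (intro sum.cong) auto
  also have "(\<Sum>w\<in>{1..4::nat}. 1 / (r - 1)) + (\<Sum>w\<in>{5..<n}. 1 / r) = 4 / (r - 1) + (real n - 5) / r"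
    using n by (simp add: of_nat_diff)
  also have "4 / (r - 1) = r\<^sup>2 - (real n - 1)"
    using r by (simp add: field_simps)
  also have "\<dots> + (real n - 5) / r = r"
  proof -
    have "r * (r\<^sup>2 - (real n - 1)) + (real n - 5) = r * r"
      using r(2) by (simp add: algebra_simps power2_eq_square)
    then show ?thesis
      using r(1) by (simp add: field_simps)
  qed
  finally have "(\<Sum>w\<in>parcs ?G `` {0}. ?x w) = r" .
  with leaf have "(\<Sum>w\<in>parcs ?G `` {v}. ?x w) = r * ?x v" if "v \<in> pverts ?G" for v
    using that by (cases "v = 0") auto
  moreover have "0 \<in> pverts ?G"
    using n by (simp add: star_plus_def undirected_def)
  ultimately show ?thesis
    unfolding eigenfunction_def by force
qed

text \<open>Intermediate value theorem: the cubic is 0 at \<open>sqrt c\<close> and at least 10 at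
  \<open>sqrt c + 1\<close>, so it takes the value 4 strictly to the right of
  \<open>sqrt c\<close>.\<close>

lemma star_plus_2_equation_root:
  fixes c :: real
  assumes "c \<ge> 4"
  obtains r where "r > sqrt c" "(r\<^sup>2 - c) * (r - 1) = 4"
proof -
  let ?h = "\<lambda>r::real. (r\<^sup>2 - c) * (r - 1)"
  have s: "sqrt c \<ge> 2" "(sqrt c)\<^sup>2 = c"
    using assms real_le_rsqrt[of 2 c] by auto
  have "?h (sqrt c + 1) = (2 * sqrt c + 1) * sqrt c"
    using s(2) by (simp add: power2_sum algebra_simps)
  also have "\<dots> \<ge> 5 * 2"
    using s(1) by (intro mult_mono) auto
  finally have "?h (sqrt c + 1) \<ge> 4"
    by simp
  moreover have "?h (sqrt c) = 0"
    using s by simp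
  ultimately obtain r where "sqrt c \<le> r" "?h r = 4"
    using IVT'[of ?h "sqrt c" 4 "sqrt c + 1"] by (force intro!: continuous_intros)
  moreover from this \<open>?h (sqrt c) = 0\<close> have "r \<noteq> sqrt c"
    by force
  ultimately show thesis
    using that[of r] by simp
qed

lemma spectral_radius_star_plus_2:
  assumes "m \<ge> 6"
  obtains r where "r > sqrt (real m - 2)" "(r\<^sup>2 - (real m - 2)) * (r - 1) = 4"
    "r \<le> graph_spectral_radius (star_plus (m - 1) 2)"
proof -
  obtain r where r: "r > sqrt (real m - 2)" "(r\<^sup>2 - (real m - 2)) * (r - 1) = 4"
    using star_plus_2_equation_root[of "real m - 2"] assms by auto
  have "sqrt (real m - 2) \<ge> 1"
    using assms by simp
  with r(1) have "r > 1"
    by linarith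
  \<comment> \<open>The star has \<open>m - 1\<close> vertices, so its centre has degree
    \<open>m - 2\<close>, the constant of the cubic.\<close>
  moreover have "(r\<^sup>2 - (real (m - 1) - 1)) * (r - 1) = 4"
    using r(2) assms by (simp add: of_nat_diff)
  ultimately have "r \<le> graph_spectral_radius (star_plus (m - 1) 2)"
    using assms
    by (intro pair_graph.eigenvalue_le_spectral_radius[OF pair_graph_star_plus
      eigenfunction_star_plus_2]) auto
  with r that show thesis
    by blast
qed

section \<open>The classification\<close>

text \<open>From \<open>m \<ge> 11\<close> follows \<open>sqrt (m - 2) \<ge> 3\<close>, hence
  \<open>k > 3\<close>, as \<open>arc_counts\<close> demands.\<close>

lemma (in pair_graph) C4_free_spectral_radius_classification:
  assumes "m \<ge> 11" "\<not> bipartite G" "card (edges G) = m" "C4_free G"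
    and radius: "graph_spectral_radius (star_plus (m - 1) 2) \<le> graph_spectral_radius G"
  shows "is_graph G (star_plus m 1) \<or> is_graph G (star_plus (m - 1) 2)"
proof -
  define k where "k = graph_spectral_radius G"
  have "m \<ge> 6"
    using assms(1) by simp
  then obtain r where r: "r > sqrt (real m - 2)" "(r\<^sup>2 - (real m - 2)) * (r - 1) = 4"
      "r \<le> graph_spectral_radius (star_plus (m - 1) 2)"
    by (rule spectral_radius_star_plus_2)
  have "r \<le> k"
    using r(3) radius by (simp add: k_def)
  have "sqrt (real m - 2) \<ge> 3"
    using assms(1) by (intro real_le_rsqrt) simp
  with r(1) have "r > 3"
    by linarith
  have "(sqrt (real m - 2))\<^sup>2 < r\<^sup>2"
    using r(1) assms(1) by (intro power_strict_mono) auto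
  then have "r\<^sup>2 > real m - 2"
    using assms(1) by simp
  have "4 \<le> (k - 1) * (k\<^sup>2 - (real m - 2))"
  proof -
    \<comment> \<open>Beyond \<open>sqrt (m - 2)\<close> both factors are nonnegative and
      increasing, so the value 4 at \<open>r\<close> is a lower bound at \<open>k\<close>.\<close>
    have "(r - 1) * (r\<^sup>2 - (real m - 2)) \<le> (k - 1) * (k\<^sup>2 - (real m - 2))"
      using \<open>r \<le> k\<close> \<open>r > 3\<close> \<open>r\<^sup>2 > real m - 2\<close> by (intro mult_mono diff_mono power_mono) auto
    with r(2) show ?thesis
      by (simp add: mult.commute)
  qed
  have "pverts G \<noteq> {}"
  proof
    assume "pverts G = {}"
    then have "parcs G = {}"
      using in_arcsD1 by auto
    with \<open>pverts G = {}\<close> have "bipartite G"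
      by (simp add: bipartite_def)
    with assms(2) show False ..
  qed
  then obtain f where f: "eigenfunction G f k"
    using eigenfunction_spectral_radius unfolding k_def by blast
  obtain u where u: "u \<in> pverts G" "\<And>v. v \<in> pverts G \<Longrightarrow> \<bar>f v\<bar> \<le> \<bar>f u\<bar>"
  proof -
    have "Max ((\<lambda>v. \<bar>f v\<bar>) ` pverts G) \<in> (\<lambda>v. \<bar>f v\<bar>) ` pverts G"
      using pair_finite_verts \<open>pverts G \<noteq> {}\<close> by (intro Max_in) auto
    then obtain u where "u \<in> pverts G" "\<bar>f u\<bar> = Max ((\<lambda>v. \<bar>f v\<bar>) ` pverts G)"
      by auto
    then show thesis
      using that[of u] pair_finite_verts by simp
  qed
  have "f u \<noteq> 0"
    using f u by (force simp: eigenfunction_def)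
  \<comment> \<open>Division by \<open>f u\<close> also fixes the sign: the entry at
    \<open>u\<close> becomes 1 even if \<open>f u\<close> is negative.\<close>
  interpret C4_free_eigenfunction G "\<lambda>v. f v / f u" k u
  proof
    show "(\<Sum>w\<in>parcs G `` {v}. f w / f u) = k * (f v / f u)" if "v \<in> pverts G" for v
      using f that by (simp add: eigenfunction_def flip: sum_divide_distrib)
    show "f v / f u \<le> 1" if "v \<in> pverts G" for v
    proof -
      have "f v / f u \<le> \<bar>f v / f u\<bar>"
        by (rule abs_ge_self)
      also have "\<dots> \<le> 1"
        using u(2)[OF that] \<open>f u \<noteq> 0\<close> by (simp add: abs_divide)
      finally show ?thesis .
    qed
  qed (use assms u \<open>f u \<noteq> 0\<close> \<open>r > 3\<close> \<open>r \<le> k\<close> in auto)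
  have "\<beta> = 0 \<and> \<epsilon> = 0 \<and> (\<tau> = 2 \<or> \<tau> = 4)"
    using arc_counts assms(2,3) \<open>r > 3\<close> \<open>r \<le> k\<close> \<open>4 \<le> (k - 1) * (k\<^sup>2 - (real m - 2))\<close> by simp
  then show ?thesis
    using is_graph_star_plus_1 is_graph_star_plus_2 assms(3) by blast
qed

theorem theorem1p3:
  fixes m :: nat
  assumes "m \<ge> 51"
  shows "graph_spectral_radius (star_plus (m - 1) 2) > sqrt (real m - 2) \<and>
    (\<forall>G :: 'a pair_pre_digraph.
       pair_graph G \<and> \<not> bipartite G \<and> card (edges G) = m \<and>
       graph_spectral_radius G \<ge> graph_spectral_radius (star_plus (m - 1) 2) \<longrightarrow>
       contains_subgraph G (cycle_graph 4) \<or>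
       is_graph G (star_plus m 1) \<or>
       is_graph G (C5_star (m - 5)) \<or>
       is_graph G (star_plus (m - 1) 2))"
proof (intro conjI allI impI)
  show "graph_spectral_radius (star_plus (m - 1) 2) > sqrt (real m - 2)"
    using spectral_radius_star_plus_2[of m] assms by force
next
  fix G :: "'a pair_pre_digraph"
  assume G: "pair_graph G \<and> \<not> bipartite G \<and> card (edges G) = m \<and>
    graph_spectral_radius G \<ge> graph_spectral_radius (star_plus (m - 1) 2)"
  then interpret pair_graph G
    by blast
  show "contains_subgraph G (cycle_graph 4) \<or> is_graph G (star_plus m 1) \<or>
    is_graph G (C5_star (m - 5)) \<or> is_graph G (star_plus (m - 1) 2)"
  proof (cases "C4_free G")
    case True
    have "m \<ge> 11"
      using assms by simp
    then show ?thesis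
      using C4_free_spectral_radius_classification[of m] True G by blast
  next
    case False
    then show ?thesis
      using contains_C4I unfolding C4_free_def by blast
  qed
qed

end
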